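(* Let $I \subset R=\Bbbk[x_0,\ldots,x_n]$ be a nonzero proper square-free monomial ideal, let $\mathfrak{m}=(x_0,\ldots,x_n)$, and let $e$ be the big-height of $I$. Then for all positive integers $m$, $t$ and $r$, $$I^{(t(m+e-1)-e+r)} \subseteq \mathfrak{m}^{(t-1)(e-1)+r-1}\,\bigl(I^{(m)}\bigr)^t .$$
   Context: $\Bbbk$ is a field and $R=\Bbbk[x_0,\ldots,x_n]$. $\operatorname{Ass}(I)$ denotes the set of associated primes of $I$ (i.e. of the module $R/I$). The $m$-th symbolic power of an ideal $I$ is $I^{(m)} = R\cap\bigcap_{P\in \operatorname{Ass}(I)} I^m R_P$ (intersection taken inside the fraction field of $R$). The big-height of $I$ is the maximum of the heights of the associated primes of $I$. A square-free monomial ideal is an ideal generated by square-free monomials. *)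

theory Defs
  imports
    "HOL-Library.Poly_Mapping"
    "HOL-Library.Extended_Nat"
    "HOL-Computational_Algebra.Fraction_Field"
begin

section \<open>Ideals of a commutative ring\<close>

text \<open>Ideals are the submodules of the ring regarded as a module over itself.\<close>

global_interpretation ideal: module "(*) :: 'a::comm_ring_1 \<Rightarrow> 'a \<Rightarrow> 'a"
  defines is_ideal = ideal.subspace
    and ideal_generated = ideal.span
  by standard (simp_all add: algebra_simps)

definition prime_ideal :: "'a::comm_ring_1 set \<Rightarrow> bool" where
  "prime_ideal P \<longleftrightarrow> is_ideal P \<and> P \<noteq> UNIV \<and> (\<forall>a b. a * b \<in> P \<longrightarrow> a \<in> P \<or> b \<in> P)"

definition ideal_mult :: "'a::comm_ring_1 set \<Rightarrow> 'a set \<Rightarrow> 'a set" where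
  "ideal_mult I J = ideal_generated {a * b | a b. a \<in> I \<and> b \<in> J}"

primrec ideal_power :: "'a::comm_ring_1 set \<Rightarrow> nat \<Rightarrow> 'a set" where
  "ideal_power I 0 = UNIV"
| "ideal_power I (Suc k) = ideal_mult I (ideal_power I k)"

text \<open>A prime is associated to \<^term>\<open>I\<close> if it is the annihilator of the class of some
  \<^term>\<open>f\<close> in the module \<open>R/I\<close>; this class is nonzero because \<^term>\<open>P\<close> is proper.\<close>

definition associated_primes :: "'a::comm_ring_1 set \<Rightarrow> 'a set set" where
  "associated_primes I = {P. prime_ideal P \<and> (\<exists>f. P = {g. g * f \<in> I})}"

text \<open>The height is the supremum of the lengths \<^term>\<open>k\<close> of strict chains
  \<open>c 0 \<subset> \<dots> \<subset> c k = P\<close> of prime ideals.\<close>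

definition height :: "'a::comm_ring_1 set \<Rightarrow> enat" where
  "height P = Sup {enat k | k. \<exists>c. (\<forall>i\<le>k. prime_ideal (c i)) \<and> (\<forall>i<k. c i \<subset> c (Suc i)) \<and> c k = P}"

text \<open>In a Noetherian ring this supremum is a maximum, there being finitely many associated
  primes.\<close>

definition big_height :: "'a::comm_ring_1 set \<Rightarrow> enat" where
  "big_height I = (SUP P\<in>associated_primes I. height P)"

section \<open>Symbolic powers\<close>

text \<open>The extension \<open>J R\<^sub>P\<close> of an ideal \<^term>\<open>J\<close> to the localization at a prime \<^term>\<open>P\<close>,
  as a subset of the fraction field.\<close>

definition localized_ideal :: "'a::idom set \<Rightarrow> 'a set \<Rightarrow> 'a fract set" where
  "localized_ideal J P = {Fract a s | a s. a \<in> J \<and> s \<notin> P}"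

text \<open>The preimage under \<open>f \<mapsto> f/1\<close> is the intersection with \<open>R\<close> inside the fraction field.\<close>

definition symbolic_power :: "'a::idom set \<Rightarrow> nat \<Rightarrow> 'a set" where
  "symbolic_power I m =
     (\<lambda>f. Fract f 1) -` (\<Inter>P\<in>associated_primes I. localized_ideal (ideal_power I m) P)"

section \<open>Polynomial rings\<close>

text \<open>The variables are indexed by the type \<^typ>\<open>'n\<close>, so \<open>n + 1\<close> is its
  cardinality. Its linear order plays no mathematical role: it is what
  the library instance of class \<^class>\<open>idom\<close> for \<^type>\<open>poly_mapping\<close> requires.\<close>

type_synonym ('n, 'k) mpoly = "('n \<Rightarrow>\<^sub>0 nat) \<Rightarrow>\<^sub>0 'k"

definition monomial :: "('n \<Rightarrow>\<^sub>0 nat) \<Rightarrow> ('n, 'k::field) mpoly" where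
  "monomial \<alpha> = Poly_Mapping.single \<alpha> 1"

definition variable :: "'n \<Rightarrow> ('n, 'k::field) mpoly" where
  "variable i = monomial (Poly_Mapping.single i 1)"

definition irrelevant_ideal :: "('n, 'k::field) mpoly set" where
  "irrelevant_ideal = ideal_generated (range variable)"

definition squarefree_monomial_ideal :: "('n, 'k::field) mpoly set \<Rightarrow> bool" where
  "squarefree_monomial_ideal I \<longleftrightarrow>
     (\<exists>A. (\<forall>\<alpha>\<in>A. \<forall>i. Poly_Mapping.lookup \<alpha> i \<le> 1) \<and> I = ideal_generated (monomial ` A))"

end

theory Submission
  imports Defs
begin

text \<open>The associated primes of a square-free monomial ideal \<open>I\<close> are generated by the minimal vertex
  covers \<open>V\<close> of the generators, and their symbolic powers are tested monomial by monomial: \<open>x\<^sup>a\<close> lies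
  in \<open>I\<^sup>(\<^sup>N\<^sup>)\<close> iff \<open>\<bar>a\<bar>\<^sub>V = (\<Sum>i\<in>V. a\<^sub>i) \<ge> N\<close> for every \<open>V\<close>. If \<open>x\<^sup>a\<close> lies in the symbolic power on the
  left of the claim, then \<open>q = \<lfloor>a/t\<rfloor>\<close> satisfies \<open>\<bar>a\<bar>\<^sub>V \<le> t\<bar>q\<bar>\<^sub>V + e(t - 1)\<close>, hence \<open>\<bar>q\<bar>\<^sub>V \<ge> m\<close>. Shrinking
  \<open>q\<close> to a minimal such exponent \<open>p\<close> makes \<open>\<bar>p\<bar>\<^sub>V = m\<close> for some \<open>V\<close>, so that the cofactor of \<open>(x\<^sup>p)\<^sup>t\<close> in
  \<open>x\<^sup>a\<close> has degree at least \<open>\<bar>a\<bar>\<^sub>V - tm\<close>, which is the required exponent of the irrelevant ideal.\<close>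

section \<open>Ideals and symbolic powers\<close>

lemma is_idealI:
  assumes "0 \<in> J" "\<And>x y. x \<in> J \<Longrightarrow> y \<in> J \<Longrightarrow> x + y \<in> J" "\<And>c x. x \<in> J \<Longrightarrow> c * x \<in> J"
  shows "is_ideal J"
  using assms by (simp add: ideal.subspace_def)

lemma ideal_mult_is_ideal: "is_ideal (ideal_mult I J)"
  by (simp add: ideal_mult_def)

lemma ideal_multI: "a \<in> I \<Longrightarrow> b \<in> J \<Longrightarrow> a * b \<in> ideal_mult I J"
  unfolding ideal_mult_def by (rule ideal.span_base) blast

lemma ideal_mult_subsetI:
  assumes "is_ideal K" "\<And>a b. a \<in> I \<Longrightarrow> b \<in> J \<Longrightarrow> a * b \<in> K"
  shows "ideal_mult I J \<subseteq> K"
  unfolding ideal_mult_def by (rule ideal.span_minimal) (use assms in auto)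

lemma power_in_ideal_power: "x \<in> J \<Longrightarrow> x ^ k \<in> ideal_power J k"
  by (induction k) (simp_all add: ideal_multI)

lemma one_notin_prime_ideal:
  assumes "prime_ideal P"
  shows "1 \<notin> P"
proof
  assume "1 \<in> P"
  then have "x * 1 \<in> P" for x
    using assms unfolding prime_ideal_def ideal.subspace_def by blast
  then show False
    using assms unfolding prime_ideal_def by auto
qed

text \<open>Denominators can be cleared: \<open>0\<close> lies in \<open>P\<close>, so every
  \<open>s\<close> outside \<open>P\<close> is nonzero and \<open>f/1 = a/s\<close> amounts to
  \<open>f * s = a\<close>. Later arguments use this form and never return to the fraction
  field.\<close>

lemma symbolic_power_iff:
  "f \<in> symbolic_power I m \<longleftrightarrow>
     (\<forall>P\<in>associated_primes I. \<exists>s. s \<notin> P \<and> f * s \<in> ideal_power I m)"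
proof -
  have "Fract f 1 \<in> localized_ideal (ideal_power I m) P \<longleftrightarrow> (\<exists>s. s \<notin> P \<and> f * s \<in> ideal_power I m)"
    if "P \<in> associated_primes I" for P
  proof -
    have "0 \<in> P"
      using that by (auto simp: associated_primes_def prime_ideal_def ideal.subspace_def)
    then have eq: "Fract f 1 = Fract a s \<longleftrightarrow> f * s = a" if "s \<notin> P" for a s
      using that by (subst eq_fract) auto
    have "Fract f 1 \<in> localized_ideal (ideal_power I m) P \<longleftrightarrow>
        (\<exists>s a. s \<notin> P \<and> a \<in> ideal_power I m \<and> Fract f 1 = Fract a s)"
      unfolding localized_ideal_def by auto
    also have "\<dots> \<longleftrightarrow> (\<exists>s a. s \<notin> P \<and> a \<in> ideal_power I m \<and> f * s = a)"
      by (intro ex_cong1 conj_cong refl eq)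
    finally show ?thesis
      by simp
  qed
  then show ?thesis
    by (simp add: symbolic_power_def)
qed

section \<open>Monomials\<close>

lemma monomial_mult: "monomial a * monomial b = monomial (a + b)"
  by (simp add: monomial_def mult_single)

lemma monomial_0: "monomial 0 = 1"
  by (simp add: monomial_def)

lemma keys_monomial [simp]: "Poly_Mapping.keys (monomial a :: ('n, 'k::field) mpoly) = {a}"
  by (simp add: monomial_def)

lemma monomial_power_mult:
  fixes a p c :: "'n \<Rightarrow>\<^sub>0 nat"
  assumes "\<And>i. Poly_Mapping.lookup a i = k * Poly_Mapping.lookup p i + Poly_Mapping.lookup c i"
  shows "(monomial a :: ('n, 'k::field) mpoly) = monomial c * monomial p ^ k"
  using assms
proof (induction k arbitrary: a)
  case 0
  then have "a = c"
    by (simp add: poly_mapping_eqI)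
  then show ?case
    by simp
next
  case (Suc k)
  have "a = p + (a - p)"
    by (rule poly_mapping_eqI) (simp add: lookup_add lookup_minus Suc.prems)
  moreover have "(monomial (a - p) :: ('n, 'k) mpoly) = monomial c * monomial p ^ k"
    by (rule Suc.IH) (simp add: lookup_minus Suc.prems)
  ultimately show ?case
    by (metis monomial_mult mult.left_commute power_Suc)
qed

lemma single_add_minus:
  fixes a :: "'n \<Rightarrow>\<^sub>0 nat"
  assumes "Poly_Mapping.lookup a i \<noteq> 0"
  shows "Poly_Mapping.single i 1 + (a - Poly_Mapping.single i 1) = a"
  using assms by (intro poly_mapping_eqI) (auto simp: lookup_add lookup_minus lookup_single when_def)

lemma poly_mapping_sum_single:
  "f = (\<Sum>a\<in>Poly_Mapping.keys f. Poly_Mapping.single a (Poly_Mapping.lookup f a))"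
  by (rule poly_mapping_eqI)
    (auto simp: lookup_sum lookup_single when_def in_keys_iff)

lemma lookup_mult_monomial:
  fixes f :: "('n, 'k::field) mpoly"
  shows "Poly_Mapping.lookup (f * monomial b) (a + b) = Poly_Mapping.lookup f a"
proof -
  have "f * monomial b =
      (\<Sum>c\<in>Poly_Mapping.keys f. Poly_Mapping.single (c + b) (Poly_Mapping.lookup f c))"
    by (subst poly_mapping_sum_single[of f])
      (simp add: sum_distrib_right monomial_def mult_single)
  then show ?thesis
    by (auto simp: lookup_sum lookup_single when_def in_keys_iff)
qed

text \<open>Translating exponents by \<open>b\<close> is injective, so no terms cancel; hence an
  equality, where \<open>keys_mult\<close> gives only an inclusion.\<close>

lemma keys_mult_monomial:
  fixes f :: "('n, 'k::field) mpoly"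
  shows "Poly_Mapping.keys (f * monomial b) = (\<lambda>a. a + b) ` Poly_Mapping.keys f"
proof
  show "Poly_Mapping.keys (f * monomial b) \<subseteq> (\<lambda>a. a + b) ` Poly_Mapping.keys f"
    using keys_mult[of f "monomial b"] by auto
  show "(\<lambda>a. a + b) ` Poly_Mapping.keys f \<subseteq> Poly_Mapping.keys (f * monomial b)"
    by (auto simp: in_keys_iff lookup_mult_monomial)
qed

text \<open>Each term of \<open>f\<close> is a constant times a monomial. This is what reduces the
  final containment to single monomials.\<close>

lemma mem_ideal_if_monomials_mem:
  fixes f :: "('n, 'k::field) mpoly"
  assumes "is_ideal J" "\<And>a. a \<in> Poly_Mapping.keys f \<Longrightarrow> monomial a \<in> J"
  shows "f \<in> J"
proof -
  have "Poly_Mapping.single a (Poly_Mapping.lookup f a) \<in> J" if "a \<in> Poly_Mapping.keys f" for a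
  proof -
    have "Poly_Mapping.single a (Poly_Mapping.lookup f a) =
        Poly_Mapping.single 0 (Poly_Mapping.lookup f a) * monomial a"
      by (simp add: monomial_def mult_single)
    then show ?thesis
      using assms that by (auto simp: ideal.subspace_def)
  qed
  then have "(\<Sum>a\<in>Poly_Mapping.keys f. Poly_Mapping.single a (Poly_Mapping.lookup f a)) \<in> J"
    by (intro ideal.subspace_sum[OF assms(1)])
  then show ?thesis
    by (simp flip: poly_mapping_sum_single)
qed

lemma is_ideal_upclosed:
  assumes "\<And>a b. Q a \<Longrightarrow> Q (b + a)"
  shows "is_ideal {f :: ('n, 'k::field) mpoly. \<forall>a\<in>Poly_Mapping.keys f. Q a}"
proof (rule is_idealI)
  fix f g :: "('n, 'k) mpoly"
  assume "f \<in> {f. \<forall>a\<in>Poly_Mapping.keys f. Q a}" "g \<in> {f. \<forall>a\<in>Poly_Mapping.keys f. Q a}"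
  then show "f + g \<in> {f. \<forall>a\<in>Poly_Mapping.keys f. Q a}"
    using Poly_Mapping.keys_add[of f g] by blast
next
  fix c f :: "('n, 'k) mpoly"
  assume "f \<in> {f. \<forall>a\<in>Poly_Mapping.keys f. Q a}"
  then show "c * f \<in> {f. \<forall>a\<in>Poly_Mapping.keys f. Q a}"
    using keys_mult[of c f] assms by blast
qed simp

text \<open>Divisibility by a generator survives adding exponents, so by
  \<open>is_ideal_upclosed\<close> the condition cuts out an ideal containing the generators.
  Conversely, each monomial of \<open>f\<close> is then a multiple of a generator.\<close>

lemma monomial_ideal_iff:
  fixes f :: "('n, 'k::field) mpoly"
  shows "f \<in> ideal_generated (monomial ` A) \<longleftrightarrow>
    (\<forall>a\<in>Poly_Mapping.keys f. \<exists>\<alpha>\<in>A. \<forall>i. Poly_Mapping.lookup \<alpha> i \<le> Poly_Mapping.lookup a i)"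
    (is "_ \<longleftrightarrow> (\<forall>a\<in>_. ?Q a)")
proof
  have "ideal_generated (monomial ` A) \<subseteq> {f :: ('n, 'k) mpoly. \<forall>a\<in>Poly_Mapping.keys f. ?Q a}"
    by (intro ideal.span_minimal is_ideal_upclosed)
      (auto simp: lookup_add intro: trans_le_add2)
  then show "f \<in> ideal_generated (monomial ` A) \<Longrightarrow> \<forall>a\<in>Poly_Mapping.keys f. ?Q a"
    by blast
next
  assume *: "\<forall>a\<in>Poly_Mapping.keys f. ?Q a"
  show "f \<in> ideal_generated (monomial ` A)"
  proof (rule mem_ideal_if_monomials_mem)
    fix a assume "a \<in> Poly_Mapping.keys f"
    then obtain \<alpha> where \<alpha>: "\<alpha> \<in> A" "\<And>i. Poly_Mapping.lookup \<alpha> i \<le> Poly_Mapping.lookup a i"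
      using * by blast
    have "(a - \<alpha>) + \<alpha> = a"
      by (rule poly_mapping_eqI) (simp add: lookup_add lookup_minus \<alpha>(2))
    then have "monomial a = monomial (a - \<alpha>) * (monomial \<alpha> :: ('n, 'k) mpoly)"
      by (simp add: monomial_mult)
    also have "\<dots> \<in> ideal_generated (monomial ` A)"
      by (intro ideal.span_scale ideal.span_base) (use \<alpha>(1) in blast)
    finally show "monomial a \<in> ideal_generated (monomial ` A :: ('n, 'k) mpoly set)" .
  qed simp
qed

section \<open>Ideals generated by variables\<close>

definition weight :: "'n set \<Rightarrow> ('n \<Rightarrow>\<^sub>0 nat) \<Rightarrow> nat" where
  "weight V a = (\<Sum>i\<in>V. Poly_Mapping.lookup a i)"

text \<open>The \<open>N\<close>-th power of the prime generated by the variables in \<open>V\<close>.\<close>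

definition weight_ideal :: "'n set \<Rightarrow> nat \<Rightarrow> ('n, 'k::field) mpoly set" where
  "weight_ideal V N = {f. \<forall>a\<in>Poly_Mapping.keys f. N \<le> weight V a}"

lemma weight_add: "weight V (a + b) = weight V a + weight V b"
  by (simp add: weight_def lookup_add sum.distrib)

lemma weight_0 [simp]: "weight V 0 = 0"
  by (simp add: weight_def)

lemma weight_single:
  fixes V :: "'n::finite set"
  shows "weight V (Poly_Mapping.single i 1) = (if i \<in> V then 1 else 0)"
  by (auto simp: weight_def lookup_single when_def)

lemma weight_minus_single:
  fixes V :: "'n::finite set"
  assumes "Poly_Mapping.lookup a i \<noteq> 0"
  shows "weight V a = (if i \<in> V then 1 else 0) + weight V (a - Poly_Mapping.single i 1)"
proof -
  have "weight V (Poly_Mapping.single i 1 + (a - Poly_Mapping.single i 1)) = weight V a"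
    by (simp only: single_add_minus[OF assms])
  then show ?thesis
    by (simp only: weight_add weight_single)
qed

lemma monomial_minus_single:
  assumes "Poly_Mapping.lookup a i \<noteq> 0"
  shows "monomial a = variable i * monomial (a - Poly_Mapping.single i 1)"
  unfolding variable_def monomial_mult single_add_minus[OF assms] ..

lemma weight_mono:
  fixes W :: "'n::finite set"
  shows "V \<subseteq> W \<Longrightarrow> weight V a \<le> weight W a"
  unfolding weight_def by (rule sum_mono2) auto

lemma weight_ge_Suc_0_iff:
  fixes V :: "'n::finite set"
  shows "Suc 0 \<le> weight V a \<longleftrightarrow> (\<exists>i\<in>V. Poly_Mapping.lookup a i \<noteq> 0)"
  by (simp add: weight_def Suc_le_eq sum_nonneg_eq_0_iff flip: neq0_conv)

lemma weight_ideal_is_ideal: "is_ideal (weight_ideal V N)"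
  unfolding weight_ideal_def by (rule is_ideal_upclosed) (simp add: weight_add)

lemma monomial_in_weight_ideal_iff [simp]: "monomial a \<in> weight_ideal V N \<longleftrightarrow> N \<le> weight V a"
  by (simp add: weight_ideal_def)

lemma weight_ideal_mult:
  assumes "f \<in> weight_ideal V M" "g \<in> weight_ideal V N"
  shows "f * g \<in> weight_ideal V (M + N)"
  using keys_mult[of f g] assms unfolding weight_ideal_def
  by (fastforce simp: weight_add intro: add_mono)

lemma weight_ideal_antimono: "M \<le> N \<Longrightarrow> weight_ideal V N \<subseteq> weight_ideal V M"
  by (auto simp: weight_ideal_def)

lemma ideal_power_subset_weight_ideal:
  assumes "I \<subseteq> weight_ideal V 1"
  shows "ideal_power I N \<subseteq> weight_ideal V N"
proof (induction N)
  case 0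
  show ?case by (simp add: weight_ideal_def)
next
  case (Suc N)
  have "a * b \<in> weight_ideal V (1 + N)" if "a \<in> I" "b \<in> ideal_power I N" for a b
    using that assms Suc.IH by (intro weight_ideal_mult) auto
  then show ?case
    by (simp add: ideal_mult_subsetI weight_ideal_is_ideal)
qed

section \<open>Powers of primes generated by variables are primary\<close>

lemma split_lowest_weight:
  fixes f :: "('n, 'k::field) mpoly"
  assumes "f \<in> weight_ideal V k" "f \<notin> weight_ideal V (Suc k)"
  obtains f0 f1 where "f = f0 + f1" "f0 \<noteq> 0" "\<And>a. a \<in> Poly_Mapping.keys f0 \<Longrightarrow> weight V a = k"
    "f0 \<in> weight_ideal V k" "f1 \<in> weight_ideal V (Suc k)"
proof -
  define S where "S = {a \<in> Poly_Mapping.keys f. weight V a = k}"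
  define f0 where "f0 = (\<Sum>a\<in>S. Poly_Mapping.single a (Poly_Mapping.lookup f a))"
  have "finite S"
    by (simp add: S_def)
  then have lookup: "Poly_Mapping.lookup f0 a = (if a \<in> S then Poly_Mapping.lookup f a else 0)" for a
    by (simp add: f0_def lookup_sum lookup_single when_def)
  have keys: "Poly_Mapping.keys f0 = S"
    by (auto simp: in_keys_iff lookup S_def split: if_splits)
  have keys': "Poly_Mapping.keys (f - f0) = Poly_Mapping.keys f - S"
    by (auto simp: in_keys_iff lookup lookup_minus S_def split: if_splits)
  show thesis
  proof
    show "f = f0 + (f - f0)" by simp
    have "S \<noteq> {}"
      using assms unfolding weight_ideal_def S_def
      by (auto simp: not_less_eq_eq intro: le_antisym)
    then show "f0 \<noteq> 0" using keys by auto
    show "weight V a = k" if "a \<in> Poly_Mapping.keys f0" for a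
      using that by (simp add: keys S_def)
    then show "f0 \<in> weight_ideal V k"
      by (simp add: weight_ideal_def)
    show "f - f0 \<in> weight_ideal V (Suc k)"
      using assms(1) unfolding weight_ideal_def mem_Collect_eq keys' S_def
      by (auto simp: Suc_le_eq le_less)
  qed
qed

text \<open>Compare components of lowest weight: that of \<open>s\<close> has weight 0, that of
  \<open>f\<close> some weight \<open>k\<close>. Their product is nonzero in a domain and has weight
  \<open>k\<close>, which is impossible if \<open>f * s\<close> starts in weight
  \<open>N > k\<close>.\<close>

lemma weight_ideal_primary:
  fixes f s :: "('n::linorder, 'k::field) mpoly"
  assumes fs: "f * s \<in> weight_ideal V N" and s: "s \<notin> weight_ideal V 1"
  shows "f \<in> weight_ideal V N"
proof (rule ccontr)
  assume "f \<notin> weight_ideal V N"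
  have zero: "g \<in> weight_ideal V 0" for g :: "('n, 'k) mpoly"
    by (simp add: weight_ideal_def)
  have "\<exists>k. f \<in> weight_ideal V k \<and> f \<notin> weight_ideal V (Suc k)"
  proof (rule ccontr)
    assume "\<not> ?thesis"
    then have "f \<in> weight_ideal V k" for k
      by (induction k) (use zero in blast)+
    then show False
      using \<open>f \<notin> weight_ideal V N\<close> by blast
  qed
  then obtain k where k: "f \<in> weight_ideal V k" "f \<notin> weight_ideal V (Suc k)"
    by blast
  then have "Suc k \<le> N"
    using \<open>f \<notin> weight_ideal V N\<close> weight_ideal_antimono[of N k V] by (meson not_less_eq_eq subsetD)
  from split_lowest_weight[OF k] obtain f0 f1 where f:
    "f = f0 + f1" "f0 \<noteq> 0" "\<And>a. a \<in> Poly_Mapping.keys f0 \<Longrightarrow> weight V a = k"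
    "f0 \<in> weight_ideal V k" "f1 \<in> weight_ideal V (Suc k)"
    by blast
  obtain s0 s1 where s01:
    "s = s0 + s1" "s0 \<noteq> 0" "\<And>a. a \<in> Poly_Mapping.keys s0 \<Longrightarrow> weight V a = 0"
    "s1 \<in> weight_ideal V (Suc 0)"
    using split_lowest_weight[OF zero[of s]] s by (metis One_nat_def)
  \<comment> \<open>Every term on the right has weight at least \<open>Suc k\<close>:
    \<open>f * s\<close> by assumption, the other two because \<open>s1\<close> or \<open>f1\<close>
    contributes the extra unit.\<close>
  have "f0 * s0 = f * s - (f * s1 + f1 * s0)"
    by (simp add: f(1) s01(1) algebra_simps)
  also have "\<dots> \<in> weight_ideal V (Suc k)"
  proof (intro ideal.subspace_diff[OF weight_ideal_is_ideal] ideal.subspace_add[OF weight_ideal_is_ideal])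
    show "f * s \<in> weight_ideal V (Suc k)"
      using fs weight_ideal_antimono[OF \<open>Suc k \<le> N\<close>] by blast
    show "f * s1 \<in> weight_ideal V (Suc k)"
      using weight_ideal_mult[OF k(1) s01(4)] by simp
    show "f1 * s0 \<in> weight_ideal V (Suc k)"
      using weight_ideal_mult[OF f(5) zero[of s0]] by simp
  qed
  finally have *: "f0 * s0 \<in> weight_ideal V (Suc k)" .
  have "weight V c = k" if "c \<in> Poly_Mapping.keys (f0 * s0)" for c
    using that keys_mult[of f0 s0] f(3) s01(3) by (fastforce simp: weight_add)
  with * have "Poly_Mapping.keys (f0 * s0) = {}"
    unfolding weight_ideal_def by fastforce
  then have "f0 * s0 = 0"
    by simp
  then show False
    using f(2) s01(2) by simp
qed

section \<open>Heights, and monomials in prime ideals\<close>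

lemma prime_weight_ideal:
  fixes V :: "'n::{finite,linorder} set"
  shows "prime_ideal (weight_ideal V 1 :: ('n, 'k::field) mpoly set)"
  unfolding prime_ideal_def
proof (intro conjI allI impI)
  show "is_ideal (weight_ideal V 1 :: ('n, 'k) mpoly set)"
    by (rule weight_ideal_is_ideal)
  have "monomial 0 \<notin> (weight_ideal V 1 :: ('n, 'k) mpoly set)"
    by simp
  then show "weight_ideal V 1 \<noteq> (UNIV :: ('n, 'k) mpoly set)"
    by blast
  show "a \<in> weight_ideal V 1 \<or> b \<in> weight_ideal V 1"
    if "a * b \<in> weight_ideal V 1" for a b :: "('n, 'k) mpoly"
    using weight_ideal_primary that by blast
qed

text \<open>Adjoining the variables of \<open>V\<close> one at a time gives a strict chain of primes
  that starts at the zero ideal. With the big-height, this bounds the size of minimal covers from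
  above.\<close>

lemma card_le_height:
  fixes V :: "'n::{finite,linorder} set"
  shows "enat (card V) \<le> height (weight_ideal V 1 :: ('n, 'k::field) mpoly set)"
proof -
  obtain xs where xs: "set xs = V" "distinct xs"
    using finite_distinct_list[of V] by auto
  have len: "length xs = card V"
    using distinct_card xs by metis
  define c :: "nat \<Rightarrow> ('n, 'k) mpoly set" where "c i = weight_ideal (set (take i xs)) 1" for i
  have "c i \<subset> c (Suc i)" if "i < card V" for i
  proof
    have "set (take i xs) \<subseteq> set (take (Suc i) xs)"
      by (simp add: set_take_subset_set_take)
    from weight_mono[OF this] show "c i \<subseteq> c (Suc i)"
      unfolding c_def weight_ideal_def using order_trans by blast
    have "xs ! i \<in> set (take (Suc i) xs)"
      using that len by (simp add: take_Suc_conv_app_nth)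
    moreover have "xs ! i \<notin> set (take i xs)"
      using that len xs(2) by (auto simp: in_set_conv_nth nth_eq_iff_index_eq)
    ultimately have "monomial (Poly_Mapping.single (xs ! i) 1) \<in> c (Suc i) - c i"
      unfolding c_def by (simp add: weight_single del: One_nat_def)
    then show "c i \<noteq> c (Suc i)"
      by blast
  qed
  moreover have "c (card V) = weight_ideal V 1"
    using len xs(1) by (simp add: c_def)
  ultimately show ?thesis
    unfolding height_def
    by (intro Sup_upper CollectI exI[of _ "card V"] exI[of _ c] conjI)
      (simp_all add: c_def prime_weight_ideal del: One_nat_def)
qed

text \<open>Peel off \<open>D\<close> variables one by one; what remains is absorbed by the zeroth
  power, which is the whole ring.\<close>

lemma monomial_in_irrelevant_power:
  fixes c :: "'n::finite \<Rightarrow>\<^sub>0 nat"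
  assumes "D \<le> weight UNIV c"
  shows "(monomial c :: ('n, 'k::field) mpoly) \<in> ideal_power irrelevant_ideal D"
  using assms
proof (induction D arbitrary: c)
  case (Suc D)
  then obtain i where i: "Poly_Mapping.lookup c i \<noteq> 0"
    using weight_ge_Suc_0_iff[of UNIV c] by auto
  let ?d = "c - Poly_Mapping.single i 1"
  have "weight UNIV c = 1 + weight UNIV ?d"
    using weight_minus_single[OF i, of UNIV] by simp
  then have "monomial ?d \<in> ideal_power (irrelevant_ideal :: ('n, 'k) mpoly set) D"
    using Suc by simp
  moreover have "variable i \<in> (irrelevant_ideal :: ('n, 'k) mpoly set)"
    unfolding irrelevant_ideal_def by (rule ideal.span_base) simp
  ultimately have "variable i * monomial ?d
      \<in> ideal_power (irrelevant_ideal :: ('n, 'k) mpoly set) (Suc D)"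
    by (simp add: ideal_multI)
  then show ?case
    by (simp add: monomial_minus_single[OF i])
qed simp

lemma prime_ideal_monomialD:
  fixes P :: "('n::finite, 'k::field) mpoly set"
  assumes prime: "prime_ideal P" and "monomial a \<in> P"
  obtains i where "Poly_Mapping.lookup a i \<noteq> 0" "variable i \<in> P"
proof -
  have "\<exists>i. Poly_Mapping.lookup a i \<noteq> 0 \<and> variable i \<in> P"
    using assms(2)
  proof (induction "weight UNIV a" arbitrary: a)
    case 0
    then have "a = 0"
      by (simp add: weight_def poly_mapping_eqI)
    then show ?case
      using 0 one_notin_prime_ideal[OF prime] by (simp add: monomial_0)
  next
    case (Suc k)
    then obtain i where i: "Poly_Mapping.lookup a i \<noteq> 0"
      using weight_ge_Suc_0_iff[of UNIV a] by auto
    let ?d = "a - Poly_Mapping.single i 1"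
    have "weight UNIV a = 1 + weight UNIV ?d"
      using weight_minus_single[OF i, of UNIV] by simp
    moreover have "variable i * monomial ?d \<in> P"
      using Suc.prems by (simp add: monomial_minus_single[OF i])
    ultimately consider "variable i \<in> P" | "k = weight UNIV ?d" "monomial ?d \<in> P"
      using prime Suc.hyps(2) unfolding prime_ideal_def by auto
    then show ?case
    proof cases
      case 2
      then obtain j where "Poly_Mapping.lookup ?d j \<noteq> 0" "variable j \<in> P"
        using Suc.hyps(1) by blast
      then show ?thesis
        by (intro exI[of _ j]) (auto simp: lookup_minus)
    qed (use i in blast)
  qed
  then show thesis
    using that by blast
qed

section \<open>Minimal vertex covers\<close>

definition cover :: "('n \<Rightarrow>\<^sub>0 nat) set \<Rightarrow> 'n set \<Rightarrow> bool" where
  "cover A V \<longleftrightarrow> (\<forall>\<alpha>\<in>A. \<exists>i\<in>V. Poly_Mapping.lookup \<alpha> i \<noteq> 0)"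

text \<open>Minimality is expressed by private generators: some generator meets \<open>V\<close> in
  \<open>i\<close> alone. This is equivalent to minimality under inclusion and supplies the
  generator that the later arguments need.\<close>

definition minimal_cover :: "('n \<Rightarrow>\<^sub>0 nat) set \<Rightarrow> 'n set \<Rightarrow> bool" where
  "minimal_cover A V \<longleftrightarrow> cover A V \<and>
     (\<forall>i\<in>V. \<exists>\<alpha>\<in>A. Poly_Mapping.lookup \<alpha> i \<noteq> 0 \<and> (\<forall>j\<in>V. Poly_Mapping.lookup \<alpha> j \<noteq> 0 \<longrightarrow> j = i))"

lemma ex_minimal_cover:
  fixes A :: "('n::finite \<Rightarrow>\<^sub>0 nat) set"
  assumes "0 \<notin> A"
  obtains V where "minimal_cover A V"
proof -
  have "cover A UNIV"
    unfolding cover_def using assms by (metis UNIV_I lookup_zero poly_mapping_eqI)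
  then obtain V where V: "cover A V" "\<And>W. W \<subseteq> V \<Longrightarrow> cover A W \<Longrightarrow> W = V"
    using finite_has_minimal[of "{V. cover A V}"] by auto
  have "\<exists>\<alpha>\<in>A. Poly_Mapping.lookup \<alpha> i \<noteq> 0 \<and> (\<forall>j\<in>V. Poly_Mapping.lookup \<alpha> j \<noteq> 0 \<longrightarrow> j = i)"
    if "i \<in> V" for i
  proof -
    have "\<not> cover A (V - {i})"
      using V(2)[of "V - {i}"] that by blast
    then show ?thesis
      using V(1) unfolding cover_def by blast
  qed
  then show thesis
    using that V(1) unfolding minimal_cover_def by blast
qed

lemma minimal_cover_associated_prime:
  fixes A :: "('n::{finite,linorder} \<Rightarrow>\<^sub>0 nat) set"
  assumes sqf: "\<And>\<alpha> i. \<alpha> \<in> A \<Longrightarrow> Poly_Mapping.lookup \<alpha> i \<le> 1" and V: "minimal_cover A V"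
  shows "weight_ideal V 1 \<in> associated_primes (ideal_generated (monomial ` A) :: ('n, 'k::field) mpoly set)"
proof -
  \<comment> \<open>The prime of \<open>V\<close> is the annihilator of the class of
    \<open>x^b\<close>, the product of all variables outside \<open>V\<close>.\<close>
  define b where "b = Abs_poly_mapping (\<lambda>i. if i \<in> V then 0 else 1 :: nat)"
  have b: "Poly_Mapping.lookup b i = (if i \<in> V then 0 else 1)" for i
    unfolding b_def by (subst lookup_Abs_poly_mapping) auto
  have *: "(\<exists>\<alpha>\<in>A. \<forall>i. Poly_Mapping.lookup \<alpha> i \<le> Poly_Mapping.lookup (a + b) i) \<longleftrightarrow> 1 \<le> weight V a"
    (is "?L \<longleftrightarrow> ?R") for a
  proof
    assume ?L
    then obtain \<alpha> where \<alpha>: "\<alpha> \<in> A" "\<And>i. Poly_Mapping.lookup \<alpha> i \<le> Poly_Mapping.lookup (a + b) i"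
      by blast
    then obtain i where "i \<in> V" "Poly_Mapping.lookup \<alpha> i \<noteq> 0"
      using V unfolding minimal_cover_def cover_def by blast
    then show ?R
      using \<alpha>(2)[of i] by (auto simp: weight_ge_Suc_0_iff lookup_add b intro!: bexI[of _ i])
  next
    assume ?R
    then obtain i where i: "i \<in> V" "Poly_Mapping.lookup a i \<noteq> 0"
      by (auto simp: weight_ge_Suc_0_iff)
    then obtain \<alpha> where \<alpha>: "\<alpha> \<in> A" "\<And>j. j \<in> V \<Longrightarrow> Poly_Mapping.lookup \<alpha> j \<noteq> 0 \<Longrightarrow> j = i"
      using V unfolding minimal_cover_def by blast
    \<comment> \<open>The generator private to \<open>i\<close> divides \<open>x^(a+b)\<close>: on
      \<open>V\<close> it involves only \<open>x_i\<close>, supplied by \<open>a\<close>; off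
      \<open>V\<close> its exponents are at most 1, supplied by \<open>b\<close>.\<close>
    have "Poly_Mapping.lookup \<alpha> j \<le> Poly_Mapping.lookup (a + b) j" for j
    proof (cases "Poly_Mapping.lookup \<alpha> j = 0")
      case False
      then have "1 \<le> Poly_Mapping.lookup (a + b) j"
        using \<alpha>(2)[of j] i(2) by (cases "j \<in> V") (auto simp: lookup_add b)
      then show ?thesis
        using sqf[OF \<alpha>(1), of j] by linarith
    qed simp
    then show ?L
      using \<alpha>(1) by blast
  qed
  have "weight_ideal V 1 = {g :: ('n, 'k) mpoly. g * monomial b \<in> ideal_generated (monomial ` A)}"
    by (simp add: weight_ideal_def monomial_ideal_iff keys_mult_monomial * del: One_nat_def)
  then show ?thesis
    unfolding associated_primes_def using prime_weight_ideal by blast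
qed

text \<open>Write \<open>P\<close> as the colon ideal of \<open>f\<close>. Generators lie in
  \<open>P\<close>, so primality puts one of their variables there. Private generators come from a
  monomial \<open>x^b\<close> of \<open>f\<close> outside the ideal that every variable of
  \<open>P\<close> multiplies into the ideal.\<close>

lemma associated_prime_minimal_cover:
  fixes A :: "('n::{finite,linorder} \<Rightarrow>\<^sub>0 nat) set" and P :: "('n, 'k::field) mpoly set"
  assumes sqf: "\<And>\<alpha> i. \<alpha> \<in> A \<Longrightarrow> Poly_Mapping.lookup \<alpha> i \<le> 1"
    and P: "P \<in> associated_primes (ideal_generated (monomial ` A))"
  shows "minimal_cover A {i. variable i \<in> P}"
proof -
  let ?I = "ideal_generated (monomial ` A) :: ('n, 'k) mpoly set"
  let ?V = "{i. variable i \<in> P}"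
  let ?Q = "\<lambda>a. \<exists>\<alpha>\<in>A. \<forall>i. Poly_Mapping.lookup \<alpha> i \<le> Poly_Mapping.lookup a i"
  obtain f where f: "P = {g. g * f \<in> ?I}" and prime: "prime_ideal P"
    using P unfolding associated_primes_def by blast
  have "cover A ?V"
    unfolding cover_def
  proof
    fix \<alpha> assume "\<alpha> \<in> A"
    then have "monomial \<alpha> \<in> ?I"
      by (intro ideal.span_base) blast
    then have "f * monomial \<alpha> \<in> ?I"
      by (rule ideal.span_scale)
    then have "monomial \<alpha> \<in> P"
      unfolding f by (simp add: mult.commute)
    from prime_ideal_monomialD[OF prime this] show "\<exists>i\<in>?V. Poly_Mapping.lookup \<alpha> i \<noteq> 0"
      by blast
  qed
  moreover have "\<exists>\<alpha>\<in>A. Poly_Mapping.lookup \<alpha> i \<noteq> 0 \<and> (\<forall>j\<in>?V. Poly_Mapping.lookup \<alpha> j \<noteq> 0 \<longrightarrow> j = i)"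
    if i: "i \<in> ?V" for i
  proof (rule ccontr)
    assume neg: "\<not> ?thesis"
    have "f \<notin> ?I"
      using one_notin_prime_ideal[OF prime] unfolding f by simp
    then obtain b where b: "b \<in> Poly_Mapping.keys f" "\<not> ?Q b"
      unfolding monomial_ideal_iff by blast
    have Q: "?Q (b + Poly_Mapping.single j 1)" if "j \<in> ?V" for j
    proof -
      have "f * monomial (Poly_Mapping.single j 1) \<in> ?I"
        using that unfolding f variable_def by (simp add: mult.commute)
      then show ?thesis
        using b(1) unfolding monomial_ideal_iff keys_mult_monomial by blast
    qed
    then obtain \<alpha> where \<alpha>: "\<alpha> \<in> A"
      "\<And>k. Poly_Mapping.lookup \<alpha> k \<le> Poly_Mapping.lookup (b + Poly_Mapping.single i 1) k"
      using i by blast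
    have "Poly_Mapping.lookup \<alpha> i \<noteq> 0"
    proof
      assume "Poly_Mapping.lookup \<alpha> i = 0"
      then have "Poly_Mapping.lookup \<alpha> k \<le> Poly_Mapping.lookup b k" for k
        using \<alpha>(2)[of k] by (cases "k = i") (auto simp: lookup_add lookup_single when_def)
      then show False
        using \<alpha>(1) b(2) by blast
    qed
    \<comment> \<open>As \<open>\<alpha>\<close> is not private to \<open>i\<close>, it involves a
      second variable of \<open>P\<close>; since \<open>j \<noteq> i\<close>, that variable already
      divides \<open>x^b\<close>.\<close>
    then obtain j where j: "j \<in> ?V" "Poly_Mapping.lookup \<alpha> j \<noteq> 0" "j \<noteq> i"
      using neg \<alpha>(1) by blast
    then have "Poly_Mapping.lookup b j \<noteq> 0"
      using \<alpha>(2)[of j] by (auto simp: lookup_add lookup_single when_def)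
    moreover obtain \<beta> where \<beta>: "\<beta> \<in> A"
      "\<And>k. Poly_Mapping.lookup \<beta> k \<le> Poly_Mapping.lookup (b + Poly_Mapping.single j 1) k"
      using Q[OF j(1)] by blast
    ultimately have "Poly_Mapping.lookup \<beta> k \<le> Poly_Mapping.lookup b k" for k
      using \<beta>(2)[of k] sqf[OF \<beta>(1), of k]
      by (cases "k = j") (auto simp: lookup_add lookup_single when_def)
    then show False
      using \<beta>(1) b(2) by blast
  qed
  ultimately show ?thesis
    unfolding minimal_cover_def by blast
qed

section \<open>Symbolic powers tested by weights on minimal covers\<close>

text \<open>Localize at the prime of \<open>V\<close>: some multiple \<open>f * s\<close> lies in
  the ordinary power, hence in \<open>weight_ideal V N\<close>, and primariness removes
  \<open>s\<close>.\<close>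

lemma symbolic_power_weight:
  fixes A :: "('n::{finite,linorder} \<Rightarrow>\<^sub>0 nat) set"
  assumes "\<And>\<alpha> i. \<alpha> \<in> A \<Longrightarrow> Poly_Mapping.lookup \<alpha> i \<le> 1" and V: "minimal_cover A V"
    and f: "(f :: ('n, 'k::field) mpoly) \<in> symbolic_power (ideal_generated (monomial ` A)) N"
  shows "f \<in> weight_ideal V N"
proof -
  let ?I = "ideal_generated (monomial ` A) :: ('n, 'k) mpoly set"
  have "monomial ` A \<subseteq> (weight_ideal V 1 :: ('n, 'k) mpoly set)"
    using V by (auto simp: minimal_cover_def cover_def weight_ge_Suc_0_iff)
  then have "?I \<subseteq> weight_ideal V 1"
    by (rule ideal.span_minimal) (rule weight_ideal_is_ideal)
  then have "ideal_power ?I N \<subseteq> weight_ideal V N"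
    by (rule ideal_power_subset_weight_ideal)
  moreover obtain s where "s \<notin> weight_ideal V 1" "f * s \<in> ideal_power ?I N"
    using f minimal_cover_associated_prime[OF assms(1,2)] unfolding symbolic_power_iff by blast
  ultimately show ?thesis
    using weight_ideal_primary by blast
qed

text \<open>At an associated prime \<open>P\<close>, with \<open>V\<close> its variables, the
  private generator of \<open>i\<close> is \<open>x_i\<close> times variables outside
  \<open>V\<close>, which are units in the localization. So each \<open>x_i\<close> with
  \<open>i\<close> in \<open>V\<close> lies in the localized ideal, and \<open>m\<close> such
  factors land in its \<open>m\<close>-th power.\<close>

lemma monomial_in_symbolic_power:
  fixes A :: "('n::{finite,linorder} \<Rightarrow>\<^sub>0 nat) set"
  assumes sqf: "\<And>\<alpha> i. \<alpha> \<in> A \<Longrightarrow> Poly_Mapping.lookup \<alpha> i \<le> 1"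
    and q: "\<And>V. minimal_cover A V \<Longrightarrow> m \<le> weight V q"
  shows "(monomial q :: ('n, 'k::field) mpoly) \<in> symbolic_power (ideal_generated (monomial ` A)) m"
  unfolding symbolic_power_iff
proof
  let ?I = "ideal_generated (monomial ` A) :: ('n, 'k) mpoly set"
  fix P assume P: "P \<in> associated_primes ?I"
  define V where "V = {i. variable i \<in> P}"
  have V: "minimal_cover A V"
    unfolding V_def by (rule associated_prime_minimal_cover[OF sqf P])
  have prime: "prime_ideal P"
    using P by (simp add: associated_primes_def)
  have one: "1 \<notin> P"
    using prime by (rule one_notin_prime_ideal)
  have out: "monomial a \<notin> P" if "weight V a = 0" for a
  proof
    assume "monomial a \<in> P"
    with prime obtain i where "Poly_Mapping.lookup a i \<noteq> 0" "variable i \<in> P"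
      by (rule prime_ideal_monomialD)
    then show False
      using that by (auto simp: V_def weight_def)
  qed
  have var: "\<exists>s. s \<notin> P \<and> variable i * s \<in> ?I" if "i \<in> V" for i
  proof -
    obtain \<alpha> where \<alpha>: "\<alpha> \<in> A" "Poly_Mapping.lookup \<alpha> i \<noteq> 0"
      "\<And>j. j \<in> V \<Longrightarrow> Poly_Mapping.lookup \<alpha> j \<noteq> 0 \<Longrightarrow> j = i"
      using V \<open>i \<in> V\<close> unfolding minimal_cover_def by blast
    let ?d = "\<alpha> - Poly_Mapping.single i 1"
    have "variable i * monomial ?d = (monomial \<alpha> :: ('n, 'k) mpoly)"
      by (simp add: monomial_minus_single[OF \<alpha>(2)])
    \<comment> \<open>At \<open>j = i\<close> this is where square-freeness enters: a second factor
      \<open>x_i\<close> in the cofactor would not be a unit at \<open>P\<close>.\<close>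
    moreover have "Poly_Mapping.lookup ?d j = 0" if "j \<in> V" for j
    proof (cases "j = i")
      case True
      then show ?thesis
        using sqf[OF \<alpha>(1), of i] by (simp add: lookup_minus)
    next
      case False
      then have "Poly_Mapping.lookup \<alpha> j = 0"
        using \<alpha>(3)[OF that] by blast
      then show ?thesis
        by (simp add: lookup_minus)
    qed
    then have "weight V ?d = 0"
      by (simp add: weight_def)
    then have "monomial ?d \<notin> P"
      by (rule out)
    moreover have "monomial \<alpha> \<in> ?I"
      using \<alpha>(1) by (intro ideal.span_base) blast
    ultimately show ?thesis
      by metis
  qed
  have "\<exists>s. s \<notin> P \<and> monomial q * s \<in> ideal_power ?I m" if "m \<le> weight V q" for m q
    using that
  proof (induction m arbitrary: q)
    case 0
    then show ?case
      using one by auto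
  next
    case (Suc m)
    then obtain i where i: "i \<in> V" "Poly_Mapping.lookup q i \<noteq> 0"
      using weight_ge_Suc_0_iff[of V q] by auto
    let ?d = "q - Poly_Mapping.single i 1"
    have "weight V q = 1 + weight V ?d"
      using weight_minus_single[OF i(2), of V] i(1) by simp
    then obtain s where s: "s \<notin> P" "monomial ?d * s \<in> ideal_power ?I m"
      using Suc by (metis Suc_le_mono plus_1_eq_Suc)
    obtain s' where s': "s' \<notin> P" "variable i * s' \<in> ?I"
      using var i(1) by blast
    have "s' * s \<notin> P"
      using prime s(1) s'(1) unfolding prime_ideal_def by blast
    moreover have "monomial q * (s' * s) = (variable i * s') * (monomial ?d * s)"
      by (simp only: monomial_minus_single[OF i(2)] mult_ac)
    then have "monomial q * (s' * s) \<in> ideal_power ?I (Suc m)"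
      using ideal_multI[OF s'(2) s(2)] by (simp only: ideal_power.simps)
    ultimately show ?case
      by blast
  qed
  then show "\<exists>s. s \<notin> P \<and> monomial q * s \<in> ideal_power ?I m"
    using q[OF V] by blast
qed

section \<open>The containment\<close>

text \<open>Take an admissible exponent of least total degree. Lowering one coordinate changes each
  weight by at most 1 and must break the bound for some \<open>V\<close>, so that weight was exactly
  \<open>m\<close>.\<close>

lemma ex_minimal_exponent:
  fixes q :: "'n::finite \<Rightarrow>\<^sub>0 nat"
  assumes q: "\<And>V. V \<in> \<V> \<Longrightarrow> m \<le> weight V q" and "\<V> \<noteq> {}" "m > 0"
  obtains p V where "\<And>i. Poly_Mapping.lookup p i \<le> Poly_Mapping.lookup q i"
    "\<And>V. V \<in> \<V> \<Longrightarrow> m \<le> weight V p" "V \<in> \<V>" "weight V p = m"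
proof -
  define good where "good p \<longleftrightarrow> (\<forall>i. Poly_Mapping.lookup p i \<le> Poly_Mapping.lookup q i) \<and>
    (\<forall>V\<in>\<V>. m \<le> weight V p)" for p
  have "good q"
    using q by (simp add: good_def)
  then obtain p where p: "good p" "\<And>p'. good p' \<Longrightarrow> weight UNIV p \<le> weight UNIV p'"
    using ex_has_least_nat[of good q "weight UNIV"] by blast
  \<comment> \<open>A nonempty family and \<open>m > 0\<close> ensure that \<open>p\<close> has a
    nonzero coordinate to lower.\<close>
  obtain W where "W \<in> \<V>"
    using assms(2) by blast
  then have "Suc 0 \<le> weight W p"
    using p(1) \<open>m > 0\<close> unfolding good_def by fastforce
  then obtain j where j: "Poly_Mapping.lookup p j \<noteq> 0"
    by (auto simp: weight_ge_Suc_0_iff)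
  let ?d = "p - Poly_Mapping.single j 1"
  note weight = weight_minus_single[OF j]
  have "\<not> good ?d"
    using p(2)[of ?d] weight[of UNIV] by fastforce
  moreover have "Poly_Mapping.lookup ?d i \<le> Poly_Mapping.lookup q i" for i
  proof -
    have "Poly_Mapping.lookup p i \<le> Poly_Mapping.lookup q i"
      using p(1) by (simp add: good_def)
    then show ?thesis
      by (simp add: lookup_minus)
  qed
  ultimately obtain V where V: "V \<in> \<V>" "weight V ?d < m"
    unfolding good_def using not_le by blast
  moreover have "m \<le> weight V p"
    using p(1) V(1) by (simp add: good_def)
  ultimately have "weight V p = m"
    using weight[of V] by (auto split: if_splits)
  then show thesis
    using that[of p V] p(1) V(1) unfolding good_def by blast
qed

theorem theorem1p2:
  fixes I :: "('n::{finite,linorder}, 'k::field) mpoly set"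
    and e m t r :: nat
  assumes "squarefree_monomial_ideal I"
    and "I \<noteq> {0}" and "I \<noteq> UNIV"
    and "big_height I = enat e"
    and "m > 0" and "t > 0" and "r > 0"
  shows "symbolic_power I (t * (m + e - 1) - e + r)
    \<subseteq> ideal_mult (ideal_power irrelevant_ideal ((t - 1) * (e - 1) + r - 1))
         (ideal_power (symbolic_power I m) t)"
proof
  let ?N = "t * (m + e - 1) - e + r" and ?D = "(t - 1) * (e - 1) + r - 1"
  let ?J = "ideal_mult (ideal_power irrelevant_ideal ?D) (ideal_power (symbolic_power I m) t)"
  obtain A where sqf: "\<And>\<alpha> i. \<alpha> \<in> A \<Longrightarrow> Poly_Mapping.lookup \<alpha> i \<le> 1"
    and I: "I = ideal_generated (monomial ` A)"
    using assms(1) unfolding squarefree_monomial_ideal_def by blast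
  have "A \<noteq> {}"
    using \<open>I \<noteq> {0}\<close> by (auto simp: I)
  have "0 \<notin> A"
  proof
    assume "0 \<in> A"
    then have "f \<in> I" for f
      unfolding I monomial_ideal_iff by (intro ballI bexI[of _ 0]) auto
    then show False
      using \<open>I \<noteq> UNIV\<close> by blast
  qed
  then obtain V0 where V0: "minimal_cover A V0"
    by (rule ex_minimal_cover)
  have card: "card V \<le> e" if "minimal_cover A V" for V
  proof -
    have "weight_ideal V 1 \<in> associated_primes I"
      unfolding I by (rule minimal_cover_associated_prime[OF sqf that])
    then have "height (weight_ideal V 1 :: ('n, 'k) mpoly set) \<le> big_height I"
      unfolding big_height_def by (rule SUP_upper)
    then show ?thesis
      using card_le_height[of V, where 'k = 'k] \<open>big_height I = enat e\<close> order_trans enat_ord_simps(1)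
      by metis
  qed
  have "V0 \<noteq> {}"
    using V0 \<open>A \<noteq> {}\<close> by (auto simp: minimal_cover_def cover_def)
  then have "e > 0"
    using card[OF V0] by (metis card_gt_0_iff finite order_less_le_trans)
  \<comment> \<open>With all three numbers positive, no subtraction in \<open>?N\<close> or
    \<open>?D\<close> is truncated, so \<open>?N\<close> splits as
    \<open>t * m + ?D\<close>.\<close>
  then obtain e' m' t' where Suc: "e = Suc e'" "m = Suc m'" "t = Suc t'"
    using \<open>m > 0\<close> \<open>t > 0\<close> by (metis gr0_implies_Suc)
  have N: "?N = t * m + ?D"
    using \<open>r > 0\<close> by (simp add: Suc algebra_simps)
  fix f assume f: "f \<in> symbolic_power I ?N"
  show "f \<in> ?J"
  proof (rule mem_ideal_if_monomials_mem)
    fix a assume "a \<in> Poly_Mapping.keys f"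
    then have a: "?N \<le> weight V a" if "minimal_cover A V" for V
      using symbolic_power_weight[OF sqf that f[unfolded I]] by (simp add: weight_ideal_def)
    \<comment> \<open>This is the largest exponent for which \<open>(x^q)^t\<close> divides
      \<open>x^a\<close>; each coordinate loses at most \<open>t - 1\<close>.\<close>
    define q where "q = Abs_poly_mapping (\<lambda>i. Poly_Mapping.lookup a i div t)"
    have q: "Poly_Mapping.lookup q i = Poly_Mapping.lookup a i div t" for i
      unfolding q_def by (subst lookup_Abs_poly_mapping) auto
    have "m \<le> weight V q" if V: "minimal_cover A V" for V
    proof (rule ccontr)
      assume "\<not> m \<le> weight V q"
      then have "weight V q \<le> m'"
        by (simp add: Suc)
      have "Poly_Mapping.lookup a i \<le> t * Poly_Mapping.lookup q i + t'" for i
        using mod_less_divisor[of t "Poly_Mapping.lookup a i"] mult_div_mod_eq[of t "Poly_Mapping.lookup a i"]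
          \<open>t > 0\<close> Suc(3) unfolding q by linarith
      then have "weight V a \<le> (\<Sum>i\<in>V. t * Poly_Mapping.lookup q i + t')"
        unfolding weight_def by (rule sum_mono)
      also have "\<dots> = t * weight V q + card V * t'"
        by (simp add: weight_def sum.distrib sum_distrib_left)
      also have "\<dots> \<le> t * m' + e * t'"
        using \<open>weight V q \<le> m'\<close> card[OF V] by (intro add_mono mult_le_mono) auto
      \<comment> \<open>The two sides differ by exactly \<open>r\<close>.\<close>
      also have "\<dots> < t * m + ?D"
        using \<open>r > 0\<close> by (simp add: Suc algebra_simps)
      finally show False
        using a[OF V] N by simp
    qed
    then obtain p V where p: "\<And>i. Poly_Mapping.lookup p i \<le> Poly_Mapping.lookup q i"
      "\<And>V. minimal_cover A V \<Longrightarrow> m \<le> weight V p" "minimal_cover A V" "weight V p = m"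
      by (rule ex_minimal_exponent[of "{V. minimal_cover A V}" m q, unfolded mem_Collect_eq])
        (use V0 \<open>m > 0\<close> in blast)+
    \<comment> \<open>The cofactor of \<open>(x^p)^t\<close> in \<open>x^a\<close>; the subtraction
      is exact because \<open>t * p \<le> t * q \<le> a\<close> in every coordinate.\<close>
    define c where "c = Abs_poly_mapping (\<lambda>i. Poly_Mapping.lookup a i - t * Poly_Mapping.lookup p i)"
    have c: "Poly_Mapping.lookup c i = Poly_Mapping.lookup a i - t * Poly_Mapping.lookup p i" for i
      unfolding c_def by (subst lookup_Abs_poly_mapping) auto
    have "t * Poly_Mapping.lookup p i \<le> Poly_Mapping.lookup a i" for i
      using p(1)[of i] q[of i] by (metis le_trans mult_le_mono2 times_div_less_eq_dividend)
    then have a_eq: "Poly_Mapping.lookup a i = t * Poly_Mapping.lookup p i + Poly_Mapping.lookup c i" for i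
      by (simp add: c)
    then have "weight V a = t * weight V p + weight V c"
      by (simp add: weight_def sum.distrib sum_distrib_left)
    \<comment> \<open>The equality \<open>weight V p = m\<close> is essential here: the
      \<open>t\<close> copies of \<open>p\<close> use up only \<open>t * m\<close> of the weight
      \<open>?N\<close>.\<close>
    then have "?D \<le> weight V c"
      using a[OF p(3)] N p(4) by simp
    also have "\<dots> \<le> weight UNIV c"
      by (rule weight_mono) simp
    finally have "monomial c \<in> ideal_power (irrelevant_ideal :: ('n, 'k) mpoly set) ?D"
      by (rule monomial_in_irrelevant_power)
    moreover have "(monomial p :: ('n, 'k) mpoly) \<in> symbolic_power I m"
      unfolding I by (rule monomial_in_symbolic_power[OF sqf p(2)])
    ultimately have "monomial c * monomial p ^ t \<in> ?J"
      by (intro ideal_multI power_in_ideal_power)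
    then show "monomial a \<in> ?J"
      using monomial_power_mult[OF a_eq] by metis
  qed (rule ideal_mult_is_ideal)
qed

end
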